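(* Let $b\ge 2$ be an integer. For real $x\geq 0$ and integer $k\geq 3$, let $\beta(x)=\log_b((b^2-1)x+1)$ and \[f_k(x)=\frac{1}{\sqrt5}\left[(k-\beta(x))(\phi^{\beta(x)}+\phi^{-\beta(x)})+\phi^{\beta(x)+2}+\phi^{-\beta(x)-2}\right].\] If $k$ and $n$ are positive integers with $k\geq 3$ and $b^k<n\leq b^k+h_k$, then $s_b(n)<f_k(n-b^k)$.
   Context: Fix an integer $b\ge 2$. A base $b$ over-expansion of a positive integer $N$ is a word $d_kd_{k-1}\cdots d_0$ over $\{0,1,\ldots,b\}$ with $d_k\neq 0$ and $\sum_{i=0}^k d_ib^i=N$. For $n\ge 2$, $s_b(n)$ is the number of base $b$ over-expansions of $n-1$; $s_b(0)=0$, $s_b(1)=1$. The integers $h_m$ ($m\ge1$) are defined by $h_1=h_2=1$ and, for $m\geq 3$, $h_m=1+\sum_{i=0}^{\lfloor (m-3)/2\rfloor}b^{m-2-2i}$. Here $\phi=\frac{1+\sqrt5}{2}$. *)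

theory Defs
  imports Complex_Main
begin

text \<open>
  The word $d_k \cdots d_0$ is encoded as the list \<open>[d_0, \<dots>, d_k]\<close>, least significant
  digit first, so that \<open>ds ! i\<close> is $d_i$ and \<open>last ds\<close> is the leading digit $d_k$.
\<close>

definition over_expansions :: "nat \<Rightarrow> nat \<Rightarrow> nat list set" where
  "over_expansions b N =
     {ds. ds \<noteq> [] \<and> set ds \<subseteq> {0..b} \<and> last ds \<noteq> 0 \<and> (\<Sum>i<length ds. ds ! i * b ^ i) = N}"

definition over_count :: "nat \<Rightarrow> nat \<Rightarrow> nat" where
  "over_count b n = (if n = 0 then 0 else if n = 1 then 1 else card (over_expansions b (n - 1)))"

definition h_num :: "nat \<Rightarrow> nat \<Rightarrow> nat" where
  "h_num b m = (if m \<le> 2 then 1 else 1 + (\<Sum>i=0..(m - 3) div 2. b ^ (m - 2 - 2 * i)))"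

definition golden :: real where
  "golden = (1 + sqrt 5) / 2"

definition beta_log :: "nat \<Rightarrow> real \<Rightarrow> real" where
  "beta_log b x = log (real b) ((real b ^ 2 - 1) * x + 1)"

definition f_bound :: "nat \<Rightarrow> nat \<Rightarrow> real \<Rightarrow> real" where
  "f_bound b k x = 1 / sqrt 5 *
     ((real k - beta_log b x) * (golden powr beta_log b x + golden powr (- beta_log b x))
       + golden powr (beta_log b x + 2) + golden powr (- beta_log b x - 2))"

text \<open>The cardinality in the definition of \<open>over_count\<close> is a genuine count.\<close>

lemma finite_over_expansions:
  assumes "2 \<le> b"
  shows "finite (over_expansions b N)"
proof (rule finite_subset)
  show "over_expansions b N \<subseteq> {ds. set ds \<subseteq> {0..b} \<and> length ds \<le> Suc N}"
  proof
    fix ds assume ds: "ds \<in> over_expansions b N"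
    let ?k = "length ds - 1"
    from ds have ne: "ds \<noteq> []" and last: "last ds \<noteq> 0"
      and sum: "(\<Sum>i<length ds. ds ! i * b ^ i) = N"
      by (auto simp: over_expansions_def)
    have "?k < b ^ ?k" using assms by (intro power_gt_expt) auto
    also have "\<dots> \<le> ds ! ?k * b ^ ?k" using last ne by (simp add: last_conv_nth)
    also have "\<dots> \<le> N" unfolding sum[symmetric]
      by (rule member_le_sum[where f = "\<lambda>i. ds ! i * b ^ i"]) (use ne in auto)
    finally show "ds \<in> {ds. set ds \<subseteq> {0..b} \<and> length ds \<le> Suc N}"
      using ds by (auto simp: over_expansions_def)
  qed
qed (rule finite_lists_length_le, simp)

end

theory Submission
  imports Defs "HOL-Number_Theory.Fib" "HOL-Analysis.Complex_Transcendental"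
begin

text \<open>
  Write $F_m$ for the Fibonacci numbers. On $n \le b^m$ the sequence is at most $F_{m+1}$, and
  $s_b(b^{j+1} + x) = s_b(b^j + x) + s_b(x)$ for $x \le b^j$. Since $h_{m+2} = b^m + h_m$, these two
  facts show inductively that $s_b$ lies below the broken line through the points $(h_m, F_m)$, and
  therefore that $x \mapsto s_b(b^k + x)$ lies below the broken line through the points
  $(h_m, (k - m) F_m + F_{m+2})$, $2 \le m \le k$. The function $f_k$ is concave and strictly
  increasing on the relevant range, and by Binet's formula it lies strictly above each of these
  points; hence it lies strictly above the broken line.
\<close>

section \<open>Recurrences\<close>

text \<open>
  The empty word is admitted as an expansion of 0, so that \<open>s_b n = card (digit_words b (n - 1))\<close>
  also holds for \<open>n = 1\<close>.
\<close>

definition digit_words :: "nat \<Rightarrow> nat \<Rightarrow> nat list set" where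
  "digit_words b N =
     {ds. set ds \<subseteq> {0..b} \<and> (ds = [] \<or> last ds \<noteq> 0) \<and> (\<Sum>i<length ds. ds ! i * b ^ i) = N}"

lemma digit_words_0:
  assumes "0 < b"
  shows "digit_words b 0 = {[]}"
proof -
  have "ds = []" if "ds \<in> digit_words b 0" for ds
  proof (rule ccontr)
    assume ne: "ds \<noteq> []"
    with that assms have "last ds = 0"
      by (auto simp: digit_words_def last_conv_nth)
    with that ne show False by (auto simp: digit_words_def)
  qed
  then show ?thesis by (auto simp: digit_words_def)
qed

lemma over_count_eq_card:
  assumes "0 < b" "0 < n"
  shows "over_count b n = card (digit_words b (n - 1))"
proof (cases "n = 1")
  case True
  then show ?thesis using assms by (simp add: over_count_def digit_words_0)
next
  case False
  with assms have "digit_words b (n - 1) = over_expansions b (n - 1)"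
    by (auto simp: digit_words_def over_expansions_def)
  with False assms show ?thesis by (simp add: over_count_def)
qed

lemma Cons_in_digit_words_iff:
  assumes "0 < N"
  shows "d # ds \<in> digit_words b N \<longleftrightarrow> d \<le> b \<and> (\<exists>M. N = d + b * M \<and> ds \<in> digit_words b M)"
proof -
  have "(\<Sum>i<length (d # ds). (d # ds) ! i * b ^ i) = d + b * (\<Sum>i<length ds. ds ! i * b ^ i)"
    by (simp add: sum.lessThan_Suc_shift sum_distrib_left mult_ac del: sum.lessThan_Suc)
  then show ?thesis using assms by (auto simp: digit_words_def)
qed

lemma Nil_in_digit_words_iff [simp]: "[] \<in> digit_words b N \<longleftrightarrow> N = 0"
  by (auto simp: digit_words_def)

lemma finite_digit_words: "2 \<le> b \<Longrightarrow> finite (digit_words b N)"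
proof (rule finite_subset)
  show "digit_words b N \<subseteq> insert [] (over_expansions b N)"
    by (auto simp: digit_words_def over_expansions_def)
qed (simp add: finite_over_expansions)

lemma over_count_0 [simp]: "over_count b 0 = 0"
  and over_count_1 [simp]: "over_count b (Suc 0) = 1"
  by (simp_all add: over_count_def)

text \<open>The number expanded is b m + (r - 1) with 1 \<le> r - 1 < b. A lowest digit 0 or b would
  make it divisible by b, so that digit must be r - 1, and deleting it leaves an expansion of
  m.\<close>

lemma over_count_residue:
  assumes "2 \<le> b" "2 \<le> r" "r \<le> b"
  shows "over_count b (b * m + r) = over_count b (m + 1)"
proof -
  have dig: "d = r - 1 \<and> M = m" if "b * m + r - 1 = d + b * M" "d \<le> b" for d M
  proof -
    have e: "b * m + (r - 1) = b * M + d" using that assms by simp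
    have "d \<noteq> b"
    proof
      assume "d = b"
      with e have "b * m + (r - 1) = b * (M + 1)" by simp
      then have "(b * m + (r - 1)) mod b = 0" by (metis mod_mult_self1_is_0)
      moreover have "(b * m + (r - 1)) mod b = r - 1" unfolding mod_mult_self4 using assms by simp
      ultimately show False using assms by simp
    qed
    with that have "d < b" by simp
    have "(b * m + (r - 1)) mod b = (b * M + d) mod b" using e by metis
    then have "r - 1 = d" unfolding mod_mult_self4 using assms \<open>d < b\<close> by simp
    moreover from this e have "b * m = b * M" by linarith
    ultimately show ?thesis using assms by simp
  qed
  have "digit_words b (b * m + r - 1) = (#) (r - 1) ` digit_words b m" (is "?L = ?R")
  proof (rule set_eqI)
    fix w
    show "w \<in> ?L \<longleftrightarrow> w \<in> ?R"
    proof (cases w)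
      case (Cons d ds)
      have "w \<in> ?L \<longleftrightarrow> d \<le> b \<and> (\<exists>M. b * m + r - 1 = d + b * M \<and> ds \<in> digit_words b M)"
        unfolding Cons by (rule Cons_in_digit_words_iff) (use assms in auto)
      also have "\<dots> \<longleftrightarrow> w \<in> ?R"
      proof
        assume "d \<le> b \<and> (\<exists>M. b * m + r - 1 = d + b * M \<and> ds \<in> digit_words b M)"
        then show "w \<in> ?R" using dig Cons by blast
      next
        assume "w \<in> ?R"
        then have "d = r - 1" "ds \<in> digit_words b m" using Cons by auto
        then show "d \<le> b \<and> (\<exists>M. b * m + r - 1 = d + b * M \<and> ds \<in> digit_words b M)"
          using assms by (intro conjI exI[of _ m]) auto
      qed
      finally show ?thesis .
    qed (use assms in auto)
  qed
  then have "card ?L = card (digit_words b m)"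
    by (simp add: card_image)
  then show ?thesis using assms by (simp add: over_count_eq_card)
qed

text \<open>Here b m is expanded, so the lowest digit is 0 or b. Deleting it leaves an expansion of
  m or of m - 1 respectively.\<close>

lemma over_count_residue_1:
  assumes b: "2 \<le> b"
  shows "over_count b (b * m + 1) = over_count b m + over_count b (m + 1)"
\<comment> \<open>For m = 0 the digit b is impossible while m - 1 truncates to 0; the identity then
  rests on the convention s_b(0) = 0.\<close>
proof (cases "m = 0")
  case False
  have dig: "d = 0 \<and> M = m \<or> d = b \<and> M = m - 1" if "b * m = d + b * M" "d \<le> b" for d M
  proof (cases "d = b")
    case True
    with that have "b * m = b * (M + 1)" by simp
    then have "m = M + 1" using b by (metis mult_cancel1 not_numeral_le_zero)
    then show ?thesis using True by simp
  next
    case False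
    with that have "d = (b * m) mod b" by simp
    then have "d = 0" by simp
    with that b show ?thesis by simp
  qed
  have bm: "b * m = b + b * (m - 1)"
    using False by (cases m) auto
  have "digit_words b (b * m) = (#) 0 ` digit_words b m \<union> (#) b ` digit_words b (m - 1)"
    (is "?L = ?R")
  proof (rule set_eqI)
    fix w
    show "w \<in> ?L \<longleftrightarrow> w \<in> ?R"
    proof (cases w)
      case (Cons d ds)
      have "w \<in> ?L \<longleftrightarrow> d \<le> b \<and> (\<exists>M. b * m = d + b * M \<and> ds \<in> digit_words b M)"
        unfolding Cons by (rule Cons_in_digit_words_iff) (use b False in auto)
      also have "\<dots> \<longleftrightarrow> w \<in> ?R"
      proof
        assume "d \<le> b \<and> (\<exists>M. b * m = d + b * M \<and> ds \<in> digit_words b M)"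
        then show "w \<in> ?R" using dig Cons by blast
      next
        assume "w \<in> ?R"
        then have "d = 0 \<and> ds \<in> digit_words b m \<or> d = b \<and> ds \<in> digit_words b (m - 1)"
          using Cons by auto
        then show "d \<le> b \<and> (\<exists>M. b * m = d + b * M \<and> ds \<in> digit_words b M)"
          using bm by (metis add_0 le_refl zero_le)
      qed
      finally show ?thesis .
    qed (use b False in auto)
  qed
  moreover have "card ?R = card (digit_words b m) + card (digit_words b (m - 1))"
    using b by (subst card_Un_disjoint) (auto simp: finite_digit_words card_image)
  ultimately show ?thesis
    using b False by (simp add: over_count_eq_card)
qed simp

text \<open>Since n - 1 is what gets expanded, residues are taken in 1..b instead of 0..b-1. The two
  alternatives match the two recurrences.\<close>

lemma residue_cases:
  assumes "2 \<le> (b :: nat)" "0 < n"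
  obtains y where "n = b * y + 1" | y r where "n = b * y + r" "2 \<le> r" "r \<le> b"
proof (cases "(n - 1) mod b = 0")
  case True
  then have "n = b * ((n - 1) div b) + 1"
    using assms by (metis Suc_eq_plus1 Suc_pred' add.right_neutral mult_div_mod_eq)
  then show ?thesis by (rule that(1))
next
  case False
  have "n = b * ((n - 1) div b) + ((n - 1) mod b + 1)"
    using assms by (metis Suc_eq_plus1 Suc_pred' add.assoc mult_div_mod_eq)
  moreover have "2 \<le> (n - 1) mod b + 1" using False by simp
  moreover have "(n - 1) mod b + 1 \<le> b" using assms by (simp add: Suc_leI)
  ultimately show ?thesis by (rule that(2))
qed

lemma less_of_mult_le_power:
  fixes b y r m :: nat
  assumes "b * y + r \<le> b ^ Suc m" "0 < r"
  shows "y + 1 \<le> b ^ m"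
proof -
  have "b * y < b * y + r" using assms(2) by simp
  also have "\<dots> \<le> b * b ^ m" using assms(1) by simp
  finally have "b * y < b * b ^ m" .
  then have "y < b ^ m" by (metis mult_less_cancel1)
  then show ?thesis by simp
qed

section \<open>Fibonacci bounds up to a power of b, and translation by powers of b\<close>

lemma fib_mono_Suc: "fib n \<le> fib (Suc n)"
  by (cases n) auto

text \<open>The two bounds are proved together: at residue 1 a single value is a sum of two
  neighbours one level down, and a sum of two neighbours is at most such a sum plus one single
  value.\<close>

lemma over_count_block_aux:
  assumes b: "2 \<le> b"
  shows "(\<forall>n \<le> b ^ m. over_count b n \<le> fib (m + 1)) \<and>
    (\<forall>y. y + 1 \<le> b ^ m \<longrightarrow> over_count b y + over_count b (y + 1) \<le> fib (m + 2))"
proof (induction m)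
  case 0
  then show ?case by (auto simp: le_Suc_eq)
next
  case (Suc m)
  have S: "over_count b n \<le> fib (m + 1)" if "n \<le> b ^ m" for n using Suc that by blast
  have D: "over_count b y + over_count b (y + 1) \<le> fib (m + 2)" if "y + 1 \<le> b ^ m" for y
    using Suc that by blast
  have 1: "over_count b n \<le> fib (Suc m + 1)" if n: "n \<le> b ^ Suc m" for n
  proof (cases "n = 0")
    case False
    then have "0 < n" by simp
    with b show ?thesis
    proof (cases rule: residue_cases)
      case (1 y)
      then have "y + 1 \<le> b ^ m" using n less_of_mult_le_power[of b y 1 m] by simp
      with D 1 over_count_residue_1[OF b, of y] show ?thesis by simp
    next
      case (2 y r)
      then have "y + 1 \<le> b ^ m" using n less_of_mult_le_power[of b y r m] by simp
      with S[of "y + 1"] 2 over_count_residue[OF b, of r y] fib_mono_Suc[of "m + 1"]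
      show ?thesis by simp
    qed
  qed simp
  have 2: "over_count b y + over_count b (y + 1) \<le> fib (Suc m + 2)" if y: "y + 1 \<le> b ^ Suc m" for y
  proof (cases "y = 0")
    case False
    then have "0 < y" by simp
    with b show ?thesis
    proof (cases rule: residue_cases)
      case (1 z)
      then have "z + 1 \<le> b ^ m" using y less_of_mult_le_power[of b z 2 m] by simp
      with D[of z] S[of "z + 1"] 1 over_count_residue_1[OF b, of z] over_count_residue[OF b, of 2 z] b
      show ?thesis by (simp add: numeral_2_eq_2)
    next
      case (2 z r)
      show ?thesis
      \<comment> \<open>For r = b the successor of y opens the next block, giving s_b(z+1) +
        (s_b(z+1) + s_b(z+2)). Otherwise both terms equal s_b(z+1), and 2 F_{m+1} \<le>
        F_{m+3}.\<close>
      proof (cases "r = b")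
        case True
        with 2 have y1: "y + 1 = b * (z + 1) + 1" by simp
        then have "z + 2 \<le> b ^ m" using y less_of_mult_le_power[of b "z + 1" 1 m] by simp
        with D[of "z + 1"] S[of "z + 1"] 2 True over_count_residue[OF b, of r z]
          over_count_residue_1[OF b, of "z + 1"] y1
        show ?thesis by (simp add: add_ac)
      next
        case False
        have "z + 1 \<le> b ^ m" using y 2 less_of_mult_le_power[of b z "r + 1" m] by simp
        with S[of "z + 1"] 2 False over_count_residue[OF b, of r z]
          over_count_residue[OF b, of "r + 1" z]
        show ?thesis by (simp add: add.assoc)
      qed
    qed
  qed (use fib_neq_0_nat[of "Suc m"] in \<open>simp add: Suc_le_eq\<close>)
  show ?case using 1 2 by blast
qed

lemma over_count_le_fib:
  assumes "2 \<le> b" "n \<le> b ^ m"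
  shows "over_count b n \<le> fib (m + 1)"
  using over_count_block_aux[OF assms(1), of m] assms(2) by blast

text \<open>Stripping the lowest digit keeps the residue of x and lowers the exponent of the added
  power by one. The identity at x thus follows from the one at y + 1, or from the sum of those at y
  and y + 1.\<close>

lemma over_count_power_Suc_add:
  assumes b: "2 \<le> b"
  shows "x \<le> b ^ j \<Longrightarrow> over_count b (b ^ Suc j + x) = over_count b (b ^ j + x) + over_count b x"
proof (induction j arbitrary: x)
  case 0
  then consider "x = 0" | "x = 1" by (auto simp: le_Suc_eq)
  then show ?case
  proof cases
    case 1
    then show ?thesis using over_count_residue[OF b, of b 0] b by simp
  next
    case 2
    have "over_count b 2 = 1" using over_count_residue[OF b, of 2 0] b by (simp add: numeral_2_eq_2)
    then show ?thesis using 2 over_count_residue_1[OF b, of 1] by (simp add: numeral_2_eq_2)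
  qed
next
  case (Suc j)
  show ?case
  proof (cases "x = 0")
    case True
    \<comment> \<open>Zero has no residue in 1..b, so x = 0 is treated apart: by the recurrence at
      residue b, multiplying the argument by b does not change s_b.\<close>
    have "over_count b (b * Suc i) = over_count b (Suc i)" for i
      using over_count_residue[OF b, of b i] b by (simp add: add.commute)
    then have *: "over_count b (b * c) = over_count b c" for c by (cases c) auto
    show ?thesis using True *[of "b ^ Suc j"] by simp
  next
    case False
    then have "0 < x" by simp
    with b show ?thesis
    proof (cases rule: residue_cases)
      case (1 y)
      then have "y + 1 \<le> b ^ j" using Suc.prems less_of_mult_le_power[of b y 1 j] by simp
      moreover have "b ^ Suc i + x = b * (b ^ i + y) + 1" for i using 1 by (simp add: algebra_simps)
      ultimately show ?thesis
        using Suc.IH[of y] Suc.IH[of "y + 1"] 1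
        by (simp only: over_count_residue_1[OF b] add.assoc)
    next
      case (2 y r)
      then have "y + 1 \<le> b ^ j" using Suc.prems less_of_mult_le_power[of b y r j] by simp
      moreover have "b ^ Suc i + x = b * (b ^ i + y) + r" for i using 2 by (simp add: algebra_simps)
      ultimately show ?thesis
        using Suc.IH[of "y + 1"] 2
        by (simp only: over_count_residue[OF b] add.assoc)
    qed
  qed
qed

text \<open>Iterating the previous identity makes s_b(b^k + x) affine in k with slope s_b(x); this
  is the source of the factor k - beta in f_k.\<close>

lemma over_count_power_add:
  assumes b: "2 \<le> b" and "x \<le> b ^ m" "m \<le> k"
  shows "over_count b (b ^ k + x) = over_count b (b ^ m + x) + (k - m) * over_count b x"
  using assms(3)
proof (induction k rule: dec_induct)
  case (step k)
  have "b ^ m \<le> b ^ k" using step b by (intro power_increasing) auto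
  with assms(2) have "x \<le> b ^ k" by (rule order.trans)
  from over_count_power_Suc_add[OF b this] step show ?case
    by (simp add: Suc_diff_le)
qed simp

section \<open>The numbers $h_m$\<close>

lemma h_num_add_2:
  assumes "1 \<le> m"
  shows "h_num b (m + 2) = b ^ m + h_num b m"
proof -
  consider "m = 1" | "m = 2" | n where "m = n + 3"
  proof (cases "m \<le> 2")
    case False
    then have "m = (m - 3) + 3" by simp
    then show ?thesis by (rule that(3))
  qed (use assms that in linarith)
  then show ?thesis
  proof cases
    case 3
    have "(n + 2) div 2 = Suc (n div 2)" by simp
    then have "(\<Sum>i=0..(n + 2) div 2. b ^ (n + 3 - 2 * i))
        = b ^ (n + 3) + (\<Sum>i=0..n div 2. b ^ (n + 1 - 2 * i))"
      by (simp only: sum.atLeast0_atMost_Suc_shift) simp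
    then show ?thesis using 3 by (simp add: h_num_def add.commute)
  qed (auto simp: h_num_def)
qed

text \<open>The factor b^2 - 1 turns the step \<open>h_num_add_2\<close> into a telescoping one, and
  h_1 and h_2 fix the two parity constants. For even m the argument of the logarithm in beta(h_m) is
  therefore exactly b^m.\<close>

lemma h_num_closed:
  assumes "1 \<le> m"
  shows "(real b ^ 2 - 1) * real (h_num b m)
    = real b ^ m + (if even m then - 1 else real b ^ 2 - real b - 1)"
  using assms
proof (induction m rule: less_induct)
  case (less m)
  consider "m = 1" | "m = 2" | n where "m = n + 2" "1 \<le> n"
  proof (cases "m \<le> 2")
    case False
    then have "m = (m - 2) + 2" "1 \<le> m - 2" by simp_all
    then show ?thesis by (rule that(3))
  qed (use less.prems that in linarith)
  then show ?case
  proof cases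
    case 3
    then show ?thesis using less.IH[of n] h_num_add_2[of n b]
      by (simp add: algebra_simps power2_eq_square split: if_splits)
  qed (auto simp: h_num_def)
qed

lemma h_num_pos: "1 \<le> h_num b m"
  by (simp add: h_num_def)

lemma h_num_gap:
  assumes "2 \<le> b" "1 \<le> m"
  shows "real (h_num b (Suc m)) - real (h_num b m)
    = (real b ^ m + (if even m then real b else - real b)) / (real b + 1)"
proof -
  have b: "real b ^ 2 - 1 = (real b - 1) * (real b + 1)" by (simp add: algebra_simps power2_eq_square)
  have "(real b - 1) * ((real b + 1) * (real (h_num b (Suc m)) - real (h_num b m)))
      = (real b ^ 2 - 1) * real (h_num b (Suc m)) - (real b ^ 2 - 1) * real (h_num b m)"
    unfolding b by (simp add: algebra_simps)
  also have "\<dots> = (real b - 1) * (real b ^ m + (if even m then real b else - real b))"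
    using h_num_closed[of m b] h_num_closed[of "Suc m" b] assms
    by (cases "even m") (simp_all add: algebra_simps power2_eq_square)
  finally have "(real b + 1) * (real (h_num b (Suc m)) - real (h_num b m))
      = real b ^ m + (if even m then real b else - real b)"
    using assms by (subst (asm) mult_cancel_left) auto
  then show ?thesis by (simp add: field_simps)
qed

text \<open>The range starts at m = 2 because h_1 = h_2.\<close>

lemma h_num_strict:
  assumes "2 \<le> b" "2 \<le> m"
  shows "h_num b m < h_num b (Suc m)"
proof -
  have "real b ^ 1 < real b ^ m" using assms by (intro power_strict_increasing) auto
  then have "0 < real (h_num b (Suc m)) - real (h_num b m)"
    using assms by (subst h_num_gap) (auto intro!: divide_pos_pos add_pos_pos)
  then show ?thesis by simp
qed

text \<open>Keeps all x \<le> h_{m+1} inside the range x \<le> b^m in which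
  \<open>over_count_power_add\<close> and \<open>over_count_le_fib\<close> apply.\<close>

lemma h_num_le_power:
  assumes "2 \<le> b"
  shows "h_num b (Suc m) \<le> b ^ m"
proof (induction m rule: less_induct)
  case (less m)
  consider "m = 0" | "m = 1" | n where "m = Suc (Suc n)"
    by (metis One_nat_def nat.exhaust)
  then show ?case
  proof cases
    case 3
    have "h_num b (Suc m) = b ^ Suc n + h_num b (Suc n)"
      using h_num_add_2[of "Suc n" b] 3 by simp
    also have "\<dots> \<le> b ^ Suc n + b ^ n" using less.IH[of n] 3 by simp
    also have "\<dots> \<le> 2 * b ^ Suc n" using assms by simp
    also have "\<dots> \<le> b ^ m" using assms 3 by simp
    finally show ?thesis .
  qed (use assms in \<open>auto simp: h_num_def\<close>)
qed

lemma h_num_interval: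
  assumes "1 \<le> x" "x < h_num b j"
  obtains m where "2 \<le> m" "m < j" "h_num b m \<le> x" "x < h_num b (Suc m)"
proof -
  have "\<exists>m. 2 \<le> m \<and> m < j \<and> h_num b m \<le> x \<and> x < h_num b (Suc m)"
    using assms(2)
  proof (induction j)
    case (Suc j)
    show ?case
    proof (cases "x < h_num b j")
      case True
      then show ?thesis using Suc.IH by (meson less_SucI)
    next
      case False
      moreover have "2 \<le> j" using Suc.prems assms(1) by (auto simp: h_num_def split: if_splits)
      ultimately show ?thesis using Suc.prems by (intro exI[of _ j]) auto
    qed
  qed (use assms(1) in \<open>simp add: h_num_def\<close>)
  then show ?thesis using that by blast
qed

section \<open>The concave majorant\<close>

text \<open>
  \<open>knot_value j m\<close> is the value at \<open>x = h_m\<close> of the broken line bounding \<open>s_b (b ^ j + x)\<close>.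
\<close>

definition knot_value :: "nat \<Rightarrow> nat \<Rightarrow> real" where
  "knot_value j m = (real j - real m) * real (fib m) + real (fib (m + 2))"

definition knot_param :: "nat \<Rightarrow> nat \<Rightarrow> nat \<Rightarrow> real" where
  "knot_param b m x = (real x - real (h_num b m)) / (real (h_num b (Suc m)) - real (h_num b m))"

text \<open>The increment is (j - m)(F_{m+1} - F_m), since the remaining terms cancel by F_{m+3} -
  F_{m+2} = F_{m+1}. Hence knot values do not decrease while m \<le> j.\<close>

lemma knot_value_Suc:
  assumes "1 \<le> m"
  shows "knot_value j (Suc m) = knot_value j m + (real j - real m) * real (fib (m - 1))"
  using assms by (cases m) (auto simp: knot_value_def algebra_simps)

text \<open>The right-hand side is the line through (h_{j+1}, F_{j+1}) and (h_{j+2}, F_{j+2}), moved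
  left by b^j = h_{j+2} - h_j and evaluated at h_\<mu>. Its rise is F_j. So the knots for s_b(b^j +
  x) lie below the segment to be established for s_b.\<close>

lemma knot_value_le_chord:
  assumes b: "2 \<le> b" and "2 \<le> \<mu>" "\<mu> \<le> j"
  shows "knot_value j \<mu> \<le> real (fib (j + 2)) - real (fib j) *
    ((real (h_num b j) - real (h_num b \<mu>)) / (real (h_num b (j + 2)) - real (h_num b (j + 1))))"
proof -
  define D where "D = real (h_num b (j + 2)) - real (h_num b (j + 1))"
  have D0: "0 < D" using h_num_strict[of b "j + 1"] assms by (simp add: D_def)
  have Deq: "D = (real b ^ (j + 1) + (if even (j + 1) then real b else - real b)) / (real b + 1)"
    using h_num_gap[OF b, of "j + 1"] by (simp add: D_def)
  consider "\<mu> = j" | "j = \<mu> + 1" | "\<mu> + 2 \<le> j" using assms by linarith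
  then have "knot_value j \<mu> \<le> real (fib (j + 2)) - real (fib j) * ((real (h_num b j) - real (h_num b \<mu>)) / D)"
  proof cases
    case 1
    then show ?thesis by (simp add: knot_value_def)
  next
    case 2
    have b1: "0 < real b + 1" by simp
    have p: "real b ^ 2 \<le> real b ^ \<mu>" using b assms by (intro power_increasing) auto
    have b2: "2 * real b \<le> real b ^ 2" using b by (simp add: power2_eq_square)
    have q: "4 * real b ^ \<mu> \<le> real b ^ (\<mu> + 2)"
    proof -
      have "2 * 2 \<le> real b * real b" using b by (intro mult_mono) auto
      then have "4 * real b ^ \<mu> \<le> (real b * real b) * real b ^ \<mu>" by (intro mult_right_mono) auto
      then show ?thesis by (simp add: mult_ac)
    qed
    have e: "(if even \<mu> then real b else - real b) \<le> real b" by simp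
    \<comment> \<open>The gaps at \<mu> and \<mu> + 2 carry the same parity correction, so a ratio
      of at most 1/3 needs only 4 b^\<mu> \<le> b^(\<mu>+2) and 2 b \<le> b^\<mu>. On the value
      side, F_j / 3 \<le> F_{\<mu>-1}, which is the distance to F_{j+2}.\<close>
    have "(real b + 1) * (3 * (real (h_num b j) - real (h_num b \<mu>)))
        = 3 * (real b ^ \<mu> + (if even \<mu> then real b else - real b))"
      using h_num_gap[OF b, of \<mu>] 2 assms b1 by simp
    also have "\<dots> \<le> real b ^ (\<mu> + 2) + (if even \<mu> then real b else - real b)"
      using order.trans[OF b2 p] q e by argo
    also have "\<dots> = (real b + 1) * D"
      using Deq 2 b1 by simp
    finally have "3 * (real (h_num b j) - real (h_num b \<mu>)) \<le> D"
      using b1 by simp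
    then have r: "(real (h_num b j) - real (h_num b \<mu>)) / D \<le> 1 / 3"
      using D0 by (simp add: field_simps)
    obtain i where i: "\<mu> = Suc (Suc i)"
    proof
      show "\<mu> = Suc (Suc (\<mu> - 2))" using assms(2) by simp
    qed
    have "real (fib j) * ((real (h_num b j) - real (h_num b \<mu>)) / D) \<le> real (fib j) * (1 / 3)"
      using r by (intro mult_left_mono) auto
    moreover have "real (fib i) \<le> real (fib (Suc i))" by (simp add: fib_mono_Suc)
    moreover have "knot_value j \<mu> = real (fib (j + 2)) - real (fib (Suc i))"
      using 2 i by (simp add: knot_value_def)
    moreover have "real (fib j) = 2 * real (fib (Suc i)) + real (fib i)"
      using 2 i by simp
    ultimately show ?thesis by argo
  next
    case 3
    \<comment> \<open>By monotonicity it suffices to treat the value at j - 2, which stays at least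
      F_j / 2 below F_{j+2}; the horizontal ratio is then bounded by 1/2.\<close>
    have "knot_value j \<mu> \<le> knot_value j (j - 2)"
      using 3 assms(2)
    proof (induction "j - 2 - \<mu>" arbitrary: \<mu>)
      case 0
      then have "\<mu> = j - 2" by simp
      then show ?case by simp
    next
      case (Suc d)
      then have "knot_value j (Suc \<mu>) \<le> knot_value j (j - 2)" by simp
      moreover have "0 \<le> (real j - real \<mu>) * real (fib (\<mu> - 1))"
        using Suc.prems by (intro mult_nonneg_nonneg) auto
      moreover have "knot_value j (Suc \<mu>) = knot_value j \<mu> + (real j - real \<mu>) * real (fib (\<mu> - 1))"
        using Suc.prems by (intro knot_value_Suc) simp
      ultimately show ?case by argo
    qed
    moreover obtain i where i: "j = Suc (Suc (Suc (Suc i)))"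
    proof
      show "j = Suc (Suc (Suc (Suc (j - 4))))" using 3 assms(2) by simp
    qed
    have "knot_value j (j - 2) + real (fib j) * (1 / 2) \<le> real (fib (j + 2))"
      using fib_mono_Suc[of i] unfolding i by (simp add: knot_value_def)
    moreover have "real (fib j) * ((real (h_num b j) - real (h_num b \<mu>)) / D) \<le> real (fib j) * (1 / 2)"
    proof (intro mult_left_mono)
      have b1: "0 < real b ^ 2 - 1" using b by simp
      have e: "(real b ^ 2 - 1) * D = (real b - 1) * (real b ^ (j + 1) + (if even (j + 1) then real b else - real b))"
        unfolding Deq by (simp add: power2_eq_square field_simps)
      have p: "2 * real b ^ j \<le> (real b - 1) * real b ^ (j + 1)"
      proof -
        have "1 * 2 \<le> (real b - 1) * real b" using b by (intro mult_mono) auto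
        then have "2 * real b ^ j \<le> ((real b - 1) * real b) * real b ^ j" by (intro mult_right_mono) auto
        then show ?thesis by (simp add: mult_ac)
      qed
      \<comment> \<open>Replacing h_\<mu> by its lower bound 1 makes the estimate uniform in
        \<mu>.\<close>
      have "(real b ^ 2 - 1) * (2 * (real (h_num b j) - 1)) \<le> (real b ^ 2 - 1) * D"
      proof -
        have "(real b ^ 2 - 1) * (2 * (real (h_num b j) - 1))
            = 2 * (real b ^ j + (if even j then - 1 else real b ^ 2 - real b - 1)) - 2 * (real b ^ 2 - 1)"
          using h_num_closed[of j b] i by (simp add: algebra_simps)
        also have "\<dots> = 2 * real b ^ j - 2 * (if even j then real b ^ 2 else real b)" by simp
        also have "\<dots> \<le> (real b ^ 2 - 1) * D"
        proof (cases "even j")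
          case True
          with p b show ?thesis unfolding e
            by (simp add: algebra_simps power2_eq_square) (intro add_increasing; simp)
        next
          case False
          with p b show ?thesis unfolding e
            by (simp add: algebra_simps) (intro add_increasing; simp)
        qed
        finally show ?thesis .
      qed
      then have "2 * (real (h_num b j) - 1) \<le> D" using b1 by simp
      moreover have "1 \<le> real (h_num b \<mu>)" using h_num_pos[of b \<mu>] by simp
      ultimately show "(real (h_num b j) - real (h_num b \<mu>)) / D \<le> 1 / 2"
        using D0 by (simp add: field_simps)
    qed simp
    ultimately show ?thesis by linarith
  qed
  then show ?thesis by (simp add: D_def)
qed

section \<open>Interpolation between consecutive knots\<close>

lemma knot_param_bounds:
  assumes "2 \<le> b" "2 \<le> m" "h_num b m \<le> x" "x \<le> h_num b (Suc m)"
  shows "0 \<le> knot_param b m x" "knot_param b m x \<le> 1"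
  using assms h_num_strict[of b m] by (auto simp: knot_param_def field_simps)

lemma knot_param_combination:
  assumes "2 \<le> b" "2 \<le> m"
  shows "real x = (1 - knot_param b m x) * real (h_num b m) + knot_param b m x * real (h_num b (Suc m))"
proof -
  have "knot_param b m x * (real (h_num b (Suc m)) - real (h_num b m)) = real x - real (h_num b m)"
    using assms h_num_strict[of b m] by (simp add: knot_param_def)
  then show ?thesis by (simp add: algebra_simps)
qed

text \<open>Split s_b(b^j + x) as s_b(b^m + x) + (j - m) s_b(x). The first term is at most F_{m+2}
  on the whole piece, and the knot values at m and m + 1 are F_{m+2} plus (j - m) F_m and (j - m)
  F_{m+1}, so nothing is lost in the interpolation.\<close>

lemma over_count_power_add_le_chord:
  assumes b: "2 \<le> b" and m: "2 \<le> m" "m \<le> j" and x: "h_num b m \<le> x" "x \<le> h_num b (Suc m)"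
    and s: "real (over_count b x)
      \<le> (1 - knot_param b m x) * real (fib m) + knot_param b m x * real (fib (Suc m))"
  shows "real (over_count b (b ^ j + x))
    \<le> (1 - knot_param b m x) * knot_value j m + knot_param b m x * knot_value j (Suc m)"
proof -
  have xb: "x \<le> b ^ m" using x h_num_le_power[OF b, of m] by simp
  have "b ^ m + x \<le> 2 * b ^ m" using xb by simp
  also have "\<dots> \<le> b ^ (m + 1)" using b by simp
  finally have "real (over_count b (b ^ m + x)) \<le> real (fib (m + 2))"
    using over_count_le_fib[OF b, of "b ^ m + x" "m + 1"] by simp
  moreover have "(real j - real m) * real (over_count b x)
      \<le> (real j - real m) * ((1 - knot_param b m x) * real (fib m) + knot_param b m x * real (fib (Suc m)))"
    using s m by (intro mult_left_mono) auto
  ultimately have "real (over_count b (b ^ j + x)) \<le> real (fib (m + 2)) +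
      (real j - real m) * ((1 - knot_param b m x) * real (fib m) + knot_param b m x * real (fib (Suc m)))"
    using over_count_power_add[OF b xb m(2)] m by (simp add: of_nat_diff)
  also have "\<dots> = (1 - knot_param b m x) * knot_value j m + knot_param b m x * knot_value j (Suc m)"
    by (simp add: knot_value_def algebra_simps)
  finally show ?thesis .
qed

text \<open>With m = j + 1, values up to b^j are at most F_m, the minimum of the segment. Beyond, x
  = b^j + y with y \<le> h_j; for y < h_j the induction hypothesis on the piece containing y bounds
  s_b(x) by the knots for j, which lie below the segment.\<close>

lemma over_count_le_chord:
  assumes b: "2 \<le> b"
  shows "2 \<le> m \<Longrightarrow> h_num b m \<le> x \<Longrightarrow> x \<le> h_num b (Suc m) \<Longrightarrow>
    real (over_count b x) \<le> (1 - knot_param b m x) * real (fib m) + knot_param b m x * real (fib (Suc m))"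
proof (induction m arbitrary: x rule: less_induct)
  case (less m)
  define t where "t = knot_param b m x"
  have t: "0 \<le> t" "t \<le> 1" using knot_param_bounds[OF b less.prems] by (auto simp: t_def)
  obtain j where j: "m = Suc j" "1 \<le> j" using less.prems(1) by (cases m) auto
  have hm: "h_num b (Suc m) = b ^ j + h_num b j" using h_num_add_2[of j b] j by simp
  consider "x \<le> b ^ j" | "x = h_num b (Suc m)" | "b ^ j < x" "x < h_num b (Suc m)"
    using less.prems by linarith
  then show ?case
  proof cases
    case 1
    have "real (over_count b x) \<le> real (fib m)" using over_count_le_fib[OF b 1] j by simp
    also have "\<dots> \<le> real (fib m) + t * (real (fib (Suc m)) - real (fib m))"
      using t fib_mono_Suc[of m] by simp
    finally show ?thesis unfolding t_def by (simp add: algebra_simps)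
  next
    \<comment> \<open>The right endpoint corresponds to y = h_j, which \<open>h_num_interval\<close>
      does not cover.\<close>
    case 2
    have "t = 1" using 2 h_num_strict[OF b less.prems(1)] by (simp add: t_def knot_param_def)
    moreover have "over_count b x \<le> fib (Suc m)"
      using over_count_le_fib[OF b, of x m] 2 h_num_le_power[OF b, of m] by simp
    ultimately show ?thesis unfolding t_def by simp
  next
    case 3
    define y where "y = x - b ^ j"
    have y: "1 \<le> y" "y < h_num b j" "x = b ^ j + y" using 3 hm by (auto simp: y_def)
    obtain \<mu> where \<mu>: "2 \<le> \<mu>" "\<mu> < j" "h_num b \<mu> \<le> y" "y < h_num b (Suc \<mu>)"
      using h_num_interval[OF y(1,2)] by blast
    define D where "D = real (h_num b (Suc m)) - real (h_num b m)"
    define w where "w = knot_param b \<mu> y"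
    have w: "0 \<le> w" "w \<le> 1" using knot_param_bounds[OF b, of \<mu> y] \<mu> by (auto simp: w_def)
    have yw: "real y = (1 - w) * real (h_num b \<mu>) + w * real (h_num b (Suc \<mu>))"
      unfolding w_def by (rule knot_param_combination[OF b \<mu>(1)])
    \<comment> \<open>c is the slope of the target segment. The bound \<open>ch\<close> is affine in
      h_\<nu>, so interpolating it between two knots evaluates the same line at y.\<close>
    define c where "c = real (fib j) / D"
    have ch: "knot_value j \<nu> \<le> real (fib (j + 2)) - c * (real (h_num b j) - real (h_num b \<nu>))"
      if "2 \<le> \<nu>" "\<nu> \<le> j" for \<nu>
      using knot_value_le_chord[OF b that] j by (simp add: c_def D_def)
    have "real (over_count b x) \<le> (1 - w) * knot_value j \<mu> + w * knot_value j (Suc \<mu>)"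
      unfolding y(3) w_def
      using \<mu> j less.IH[of \<mu> y] by (intro over_count_power_add_le_chord[OF b]) auto
    also have "\<dots> \<le> (1 - w) * (real (fib (j + 2)) - c * (real (h_num b j) - real (h_num b \<mu>)))
        + w * (real (fib (j + 2)) - c * (real (h_num b j) - real (h_num b (Suc \<mu>))))"
      using w \<mu> by (intro add_mono mult_left_mono ch) auto
    also have "\<dots> = real (fib (j + 2)) - c * (real (h_num b j) - real y)"
      unfolding yw by (simp add: algebra_simps)
    also have "real (h_num b j) - real y = real (h_num b (Suc m)) - real x"
      using hm y by simp
    also have "\<dots> = (1 - t) * D"
      using knot_param_combination[OF b less.prems(1), of x] by (simp add: D_def t_def algebra_simps)
    also have "c * ((1 - t) * D) = (1 - t) * real (fib j)"
      using h_num_strict[OF b less.prems(1)] by (simp add: c_def D_def)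
    also have "real (fib (j + 2)) - (1 - t) * real (fib j)
        = (1 - t) * real (fib m) + t * real (fib (Suc m))"
      using j by (simp add: algebra_simps)
    finally show ?thesis by (simp add: t_def)
  qed
qed

section \<open>Numerical bounds\<close>

lemma golden_bounds: "1618 / 1000 \<le> golden" "golden \<le> 1619 / 1000"
proof -
  have "2236 / 1000 \<le> sqrt 5" by (rule real_le_rsqrt) (simp add: power2_eq_square)
  moreover have "sqrt 5 \<le> 2238 / 1000" by (rule real_le_lsqrt) (simp_all add: power2_eq_square)
  ultimately show "1618 / 1000 \<le> golden" "golden \<le> 1619 / 1000" by (simp_all add: golden_def)
qed

lemma golden_square: "golden ^ 2 = golden + 1"
  by (simp add: golden_def power2_eq_square field_simps)

lemma golden_gt_1: "1 < golden"
  using golden_bounds by simp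

text \<open>Since e < 2.72, the hypothesis gives e^p \<le> x^q. Rational lower bounds for logarithms
  thereby become integer power comparisons.\<close>

lemma ln_ge_of_power:
  assumes "(272 / 100 :: real) ^ p \<le> x ^ q" "0 < q" "0 < x"
  shows "real p / real q \<le> ln x"
proof -
  have "exp (real p) = exp 1 ^ p" by (metis exp_of_nat_mult mult.right_neutral)
  also have "\<dots> \<le> (272 / 100) ^ p" using e_less_272 by (intro power_mono) auto
  also have "\<dots> \<le> x ^ q" by fact
  also have "x ^ q = exp (real q * ln x)" using assms by (simp add: exp_of_nat_mult)
  finally have "real p \<le> real q * ln x" by simp
  then show ?thesis using assms by (simp add: field_simps)
qed

lemma ln_golden_ge: "8 / 17 \<le> ln golden"
proof -
  have "(272 / 100 :: real) ^ 8 \<le> (1618 / 1000) ^ 17" by (simp add: power_divide)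
  also have "\<dots> \<le> golden ^ 17" using golden_bounds by (intro power_mono) auto
  finally show ?thesis using ln_ge_of_power[of 8 golden 17] golden_gt_1 by simp
qed

lemma ln_golden_le: "ln golden \<le> 1 / 2"
proof -
  have "golden \<le> 1 + 1 / 2 + (1 / 2) ^ 2 / (2 :: real)" using golden_bounds by (simp add: power2_eq_square)
  also have "\<dots> \<le> exp (1 / 2)" by (rule exp_lower_Taylor_quadratic) simp
  finally have "ln golden \<le> ln (exp (1 / 2))" using golden_gt_1 by (subst ln_le_cancel_iff) auto
  then show ?thesis by simp
qed

text \<open>9/13 lies just below ln 2, so one constant serves all bases.\<close>

lemma ln_base_ge:
  assumes "2 \<le> b"
  shows "9 / 13 \<le> ln (real b)"
proof -
  have "(272 / 100 :: real) ^ 9 \<le> 2 ^ 13" by (simp add: power_divide)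
  also have "\<dots> \<le> real b ^ 13" using assms by (intro power_mono) auto
  finally show ?thesis using ln_ge_of_power[of 9 "real b" 13] assms by simp
qed

section \<open>Growth and concavity of the bounding function\<close>

text \<open>\<open>gbound k t\<close> is \<open>sqrt 5 * f_k x\<close> in terms of \<open>t = beta x\<close>.\<close>

definition gbound :: "real \<Rightarrow> real \<Rightarrow> real" where
  "gbound k t = (k - t) * (golden powr t + golden powr (- t))
     + golden powr (t + 2) + golden powr (- t - 2)"

definition gbound' :: "real \<Rightarrow> real \<Rightarrow> real" where
  "gbound' k t = (k - t) * ln golden * (golden powr t - golden powr (- t))
     - (golden powr t + golden powr (- t))
     + ln golden * (golden powr (t + 2) - golden powr (- t - 2))"

definition gbound'' :: "real \<Rightarrow> real \<Rightarrow> real" where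
  "gbound'' k t = (k - t) * ln golden ^ 2 * (golden powr t + golden powr (- t))
     - 2 * ln golden * (golden powr t - golden powr (- t))
     + ln golden ^ 2 * (golden powr (t + 2) + golden powr (- t - 2))"

lemma golden_powr_eq_exp: "golden powr t = exp (t * ln golden)"
  using golden_gt_1 by (simp add: powr_def)

lemma DERIV_gbound: "(gbound k has_real_derivative gbound' k t) (at t)"
  unfolding gbound_def[abs_def] gbound'_def golden_powr_eq_exp
  by (auto intro!: derivative_eq_intros simp: algebra_simps)

lemma DERIV_gbound': "(gbound' k has_real_derivative gbound'' k t) (at t)"
  unfolding gbound'_def[abs_def] gbound''_def golden_powr_eq_exp
  by (auto intro!: derivative_eq_intros simp: algebra_simps power2_eq_square)

lemma golden_powr_add_2: "golden powr (t + 2) = (golden + 1) * golden powr t"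
  using golden_gt_1 golden_square by (simp add: powr_add)

text \<open>Together with \<open>golden_powr_add_2\<close> this makes \<open>gbound'\<close> and
  \<open>gbound''\<close> linear forms in \<open>golden powr t\<close> and
  \<open>golden powr (- t)\<close>, for fixed coefficients in k - t and
  \<open>golden\<close>.\<close>

lemma golden_powr_diff_2: "golden powr (- t - 2) = (2 - golden) * golden powr (- t)"
proof -
  have "(2 - golden) * (golden + 1) = 1"
    using golden_square by (simp add: algebra_simps power2_eq_square)
  then have "golden powr (- 2) = 2 - golden"
    using golden_square golden_gt_1 by (simp add: powr_minus inverse_unique mult.commute)
  moreover have "- t - 2 = - t + - 2" by simp
  ultimately show ?thesis by (simp only: powr_add mult.commute)
qed

lemma golden_powr_minus_le:
  assumes "real n \<le> t"
  shows "golden powr (- t) \<le> golden powr t / golden ^ (2 * n)"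
proof -
  have "golden powr (- t) \<le> golden powr (t - real (2 * n))"
    using assms golden_gt_1 by (intro powr_mono) auto
  also have "\<dots> = golden powr t / golden ^ (2 * n)"
    using golden_gt_1 by (simp add: powr_diff powr_realpow del: of_nat_mult)
  finally show ?thesis .
qed

lemma golden_power_ge: "(1618 / 1000) ^ n \<le> golden ^ n"
  using golden_bounds by (intro power_mono) auto

lemma golden_powr_minus_le_2:
  assumes "2 \<le> t"
  shows "golden powr (- t) \<le> 147 / 1000 * golden powr t"
proof -
  have "1000 / 147 \<le> golden ^ 4" using golden_power_ge[of 4] by (simp add: power_divide)
  then have "golden powr t / golden ^ 4 \<le> golden powr t / (1000 / 147)"
    by (intro divide_left_mono) auto
  also have "\<dots> = 147 / 1000 * golden powr t" by simp
  finally have "golden powr t / golden ^ 4 \<le> 147 / 1000 * golden powr t" .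
  moreover have "golden powr (- t) \<le> golden powr t / golden ^ 4"
    using golden_powr_minus_le[of 2 t] assms by simp
  ultimately show ?thesis by (rule order.trans[rotated])
qed

lemma golden_powr_minus_le_3:
  assumes "3 \<le> t"
  shows "golden powr (- t) \<le> 56 / 1000 * golden powr t"
proof -
  have "1000 / 56 \<le> golden ^ 6" using golden_power_ge[of 6] by (simp add: power_divide)
  then have "golden powr t / golden ^ 6 \<le> golden powr t / (1000 / 56)"
    by (intro divide_left_mono) auto
  also have "\<dots> = 56 / 1000 * golden powr t" by simp
  finally have "golden powr t / golden ^ 6 \<le> 56 / 1000 * golden powr t" .
  moreover have "golden powr (- t) \<le> golden powr t / golden ^ 6"
    using golden_powr_minus_le[of 3 t] assms by simp
  ultimately show ?thesis by (rule order.trans[rotated])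
qed

text \<open>The margin \<open>1 / 3\<close> is needed because \<open>beta (h_k) > k\<close> when \<open>k\<close> is odd.\<close>

lemma gbound'_pos:
  assumes "3 \<le> k" "2 \<le> t" "t \<le> k + 1 / 3"
  shows "0 < gbound' k t"
proof -
  define P where "P = golden powr t"
  define Q where "Q = golden powr (- t)"
  \<comment> \<open>X is chosen so that \<open>gbound'\<close> equals ln golden * X - (P + Q). As ln
    golden \<ge> 8/17, it suffices that X exceeds 17/8 (P + Q).\<close>
  define X where "X = (k - t) * (P - Q) + (golden + 1) * P - (2 - golden) * Q"
  have P: "0 < P" and Q: "0 \<le> Q" using golden_gt_1 by (auto simp: P_def Q_def)
  have q2: "Q \<le> 147 / 1000 * P" using golden_powr_minus_le_2[OF assms(2)] by (simp add: P_def Q_def)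
  have G: "2618 / 1000 * P \<le> (golden + 1) * P" "(2 - golden) * Q \<le> 382 / 1000 * Q"
    by (rule mult_right_mono; use golden_bounds P Q in simp)+
  have X: "17 / 8 * (P + Q) < X"
  proof (cases "t \<le> k")
    case True
    then have "0 \<le> (k - t) * (P - Q)" using q2 P by (intro mult_nonneg_nonneg) auto
    then show ?thesis using G q2 P Q unfolding X_def by argo
  next
    case False
    \<comment> \<open>Here k - t is negative and costs up to (P - Q)/3. The bound Q \<le> 0.147 P
      would be too weak, but t > k \<ge> 3 gives the sharper 0.056.\<close>
    then have q3: "Q \<le> 56 / 1000 * P"
      using golden_powr_minus_le_3[of t] assms by (simp add: P_def Q_def)
    have "(- 1 / 3) * (P - Q) \<le> (k - t) * (P - Q)"
      using assms q2 P by (intro mult_right_mono) auto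
    then show ?thesis using G q3 P Q unfolding X_def by argo
  qed
  then have "8 / 17 * X \<le> ln golden * X" using ln_golden_ge P Q by (intro mult_right_mono) auto
  with X have "0 < ln golden * X - (P + Q)" by argo
  also have "\<dots> = gbound' k t"
    unfolding gbound'_def golden_powr_add_2 golden_powr_diff_2 X_def P_def Q_def
    by (simp add: algebra_simps)
  finally show ?thesis .
qed

text \<open>The second derivative of \<open>gbound\<close> at log_b u has the sign of
  \<open>gbound''\<close> - ln b * \<open>gbound'\<close>. As \<open>gbound'\<close> is positive and
  ln b \<ge> 9/13, this inequality gives concavity for every base.\<close>

lemma gbound''_le:
  assumes "3 \<le> k" "2 \<le> t" "t \<le> k + 1 / 3"
  shows "gbound'' k t \<le> 9 / 13 * gbound' k t"
proof -
  define P where "P = golden powr t"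
  define Q where "Q = golden powr (- t)"
  define c where "c = ln golden"
  \<comment> \<open>\<open>gbound''\<close> - 9/13 * \<open>gbound'\<close> equals c B + 9/13 (P +
    Q), so a sufficiently negative B is wanted; - 19/10 P is enough.\<close>
  define B where "B = (k - t) * (c * (P + Q) - 9 / 13 * (P - Q)) - 2 * (P - Q)
    + c * ((golden + 1) * P + (2 - golden) * Q) - 9 / 13 * ((golden + 1) * P - (2 - golden) * Q)"
  have c: "8 / 17 \<le> c" "c \<le> 1 / 2" using ln_golden_ge ln_golden_le by (auto simp: c_def)
  have P: "0 < P" and Q: "0 \<le> Q" using golden_gt_1 by (auto simp: P_def Q_def)
  have q2: "Q \<le> 147 / 1000 * P" using golden_powr_minus_le_2[OF assms(2)] by (simp add: P_def Q_def)
  have G: "2618 / 1000 * P \<le> (golden + 1) * P" "(golden + 1) * P \<le> 2619 / 1000 * P"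
      "0 \<le> (2 - golden) * Q" "(2 - golden) * Q \<le> 382 / 1000 * Q"
    by ((rule mult_right_mono mult_nonneg_nonneg; use golden_bounds P Q in simp)+)
  have cPQ: "c * (P + Q) \<le> 1 / 2 * (P + Q)" "0 \<le> c * (P + Q)"
    using c P Q by (auto intro!: mult_right_mono mult_nonneg_nonneg)
  have Y: "c * ((golden + 1) * P + (2 - golden) * Q) \<le> 1 / 2 * ((golden + 1) * P + (2 - golden) * Q)"
    using c G P by (intro mult_right_mono) auto
  have d: "(k - t) * (c * (P + Q) - 9 / 13 * (P - Q)) \<le> 1 / 3 * (9 / 13 * P)"
  proof (cases "t \<le> k")
    case True
    have "c * (P + Q) - 9 / 13 * (P - Q) \<le> 0" using cPQ q2 P by argo
    then have "(k - t) * (c * (P + Q) - 9 / 13 * (P - Q)) \<le> 0"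
      using True by (intro mult_nonneg_nonpos) auto
    then show ?thesis using P by simp
  next
    case False
    have "(t - k) * (9 / 13 * (P - Q) - c * (P + Q)) \<le> 1 / 3 * (9 / 13 * P)"
    proof (rule mult_mono)
      show "9 / 13 * (P - Q) - c * (P + Q) \<le> 9 / 13 * P" "0 \<le> 9 / 13 * (P - Q) - c * (P + Q)"
        using cPQ q2 P Q by argo+
    qed (use assms False in auto)
    moreover have "(t - k) * (9 / 13 * (P - Q) - c * (P + Q)) = (k - t) * (c * (P + Q) - 9 / 13 * (P - Q))"
      by (metis minus_diff_eq minus_mult_minus)
    ultimately show ?thesis by simp
  qed
  have B: "B \<le> - (19 / 10) * P"
    using d Y G q2 P Q unfolding B_def by argo
  have "c * B \<le> c * (- (19 / 10) * P)" using B c by (intro mult_left_mono) auto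
  also have "\<dots> = - (c * (19 / 10 * P))" by simp
  finally have "c * B \<le> - (c * (19 / 10 * P))" .
  moreover have "8 / 17 * (19 / 10 * P) \<le> c * (19 / 10 * P)" using c P by (intro mult_right_mono) auto
  ultimately have "c * B \<le> - (8 / 17 * (19 / 10 * P))" by argo
  with q2 P have "c * B + 9 / 13 * (P + Q) \<le> 0" by argo
  moreover have "gbound'' k t - 9 / 13 * gbound' k t = c * B + 9 / 13 * (P + Q)"
    unfolding gbound'_def gbound''_def golden_powr_add_2 golden_powr_diff_2 B_def P_def Q_def c_def
    by (simp add: field_simps power2_eq_square)
  ultimately show ?thesis by argo
qed

lemma gbound_strict_mono:
  assumes "3 \<le> k" "2 \<le> s" "s < t" "t \<le> k + 1 / 3"
  shows "gbound k s < gbound k t"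
proof (rule DERIV_pos_imp_increasing[OF assms(3)])
  fix x assume "s \<le> x" "x \<le> t"
  with assms show "\<exists>y. (gbound k has_real_derivative y) (at x) \<and> 0 < y"
    using DERIV_gbound gbound'_pos[of k x] by (intro exI[of _ "gbound' k x"]) auto
qed

text \<open>Concavity is stated in u = (b^2 - 1) x + 1, which is affine in x, so it carries over to
  x. The interval is the set of u with 2 \<le> log_b u \<le> k + 1/3.\<close>

lemma gbound_log_concave:
  assumes b: "2 \<le> b" and k: "3 \<le> k"
  shows "concave_on {real b ^ 2..real b powr (k + 1 / 3)} (\<lambda>u. gbound k (log (real b) u))"
proof (rule f''_le0_imp_concave)
  fix u assume u: "u \<in> {real b ^ 2..real b powr (k + 1 / 3)}"
  have b2: "0 < real b ^ 2" using b by simp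
  with u have u0: "0 < u" by (meson atLeastAtMost_iff less_le_trans)
  have lb: "9 / 13 \<le> ln (real b)" by (rule ln_base_ge[OF b])
  have dl: "(log (real b) has_real_derivative 1 / (ln (real b) * u)) (at u)"
    by (rule DERIV_log[OF u0])
  have dm: "((\<lambda>u. ln (real b) * u) has_real_derivative ln (real b)) (at u)"
    by (auto intro!: derivative_eq_intros)
  show "((\<lambda>u. gbound k (log (real b) u)) has_real_derivative
      gbound' k (log (real b) u) / (ln (real b) * u)) (at u)"
    using DERIV_chain2[OF DERIV_gbound dl] by simp
  show "((\<lambda>u. gbound' k (log (real b) u) / (ln (real b) * u)) has_real_derivative
      (gbound'' k (log (real b) u) - ln (real b) * gbound' k (log (real b) u)) / (ln (real b) * u) ^ 2) (at u)"
    using u0 lb by (intro DERIV_cong[OF DERIV_divide[OF DERIV_chain2[OF DERIV_gbound' dl] dm]])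
      (auto simp: field_simps power2_eq_square)
  have t: "2 \<le> log (real b) u" "log (real b) u \<le> k + 1 / 3"
  proof -
    have "log (real b) (real b ^ 2) \<le> log (real b) u" using b u b2 u0 by (subst log_le_cancel_iff) auto
    then show "2 \<le> log (real b) u" using b by (simp add: log_nat_power)
    have "log (real b) u \<le> log (real b) (real b powr (k + 1 / 3))"
      using b u u0 by (subst log_le_cancel_iff) auto
    then show "log (real b) u \<le> k + 1 / 3" using b by simp
  qed
  have "9 / 13 * gbound' k (log (real b) u) \<le> ln (real b) * gbound' k (log (real b) u)"
    using lb gbound'_pos[OF k t] by (intro mult_right_mono) auto
  with gbound''_le[OF k t]
  show "(gbound'' k (log (real b) u) - ln (real b) * gbound' k (log (real b) u)) / (ln (real b) * u) ^ 2 \<le> 0"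
    by (intro divide_nonpos_nonneg) auto
qed simp

section \<open>Binet's formula and the comparison at the knots\<close>

lemma fib_golden:
  "sqrt 5 * real (fib n) = golden powr real n - (- 1) ^ n * golden powr (- real n)"
proof -
  have "(1 - sqrt 5) / 2 = - 1 / golden"
    using golden_gt_1 golden_square by (simp add: field_simps power2_eq_square) (simp add: golden_def field_simps)
  then have "((1 - sqrt 5) / 2) ^ n = (- 1 / golden) ^ n" by (rule arg_cong)
  also have "\<dots> = (- 1) ^ n * golden powr (- real n)"
    unfolding power_divide using golden_gt_1 by (simp add: powr_minus powr_realpow divide_inverse)
  finally show ?thesis
    using fib_closed_form[of n] golden_gt_1 by (simp add: golden_def[symmetric] powr_realpow)
qed

lemma beta_log_h_num:
  assumes b: "2 \<le> b" and m: "2 \<le> m"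
  shows "even m \<Longrightarrow> beta_log b (real (h_num b m)) = real m"
    and "odd m \<Longrightarrow> real m < beta_log b (real (h_num b m))"
    and "beta_log b (real (h_num b m)) \<le> real m + 1 / 3"
proof -
  define u where "u = (real b ^ 2 - 1) * real (h_num b m) + 1"
  have bm: "0 < real b ^ m" using b by simp
  have lm: "log (real b) (real b ^ m) = real m" using b by (simp add: log_nat_power)
  have ev: "u = real b ^ m" if "even m" using h_num_closed[of m b] m that by (simp add: u_def)
  have od: "u = real b ^ m + (real b ^ 2 - real b)" if "odd m"
    using h_num_closed[of m b] m that by (simp add: u_def)
  show e: "beta_log b (real (h_num b m)) = real m" if "even m"
    using ev[OF that] lm by (simp add: beta_log_def u_def)
  have "real b < real b ^ 2" using b by (simp add: power2_eq_square)
  show "real m < beta_log b (real (h_num b m))" if "odd m"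
  proof -
    have u: "real b ^ m < u" "0 < u" using od[OF that] bm \<open>real b < real b ^ 2\<close> by linarith+
    have "log (real b) (real b ^ m) < log (real b) u"
      using b bm u by (subst log_less_cancel_iff) auto
    then show ?thesis using lm by (simp add: beta_log_def u_def)
  qed
  show "beta_log b (real (h_num b m)) \<le> real m + 1 / 3"
  proof (cases "even m")
    case True
    then show ?thesis using e by simp
  next
    case False
    then have "m \<noteq> 2" by auto
    with m have "3 \<le> m" by simp
    then have "real b ^ 3 \<le> real b ^ m" using b by (intro power_increasing) auto
    \<comment> \<open>The square yields b^2 - b \<le> b^3 / 4, so for odd m \<ge> 3 the excess over
      b^m is at most a quarter of b^m.\<close>
    moreover have "0 \<le> real b * (real b - 2) ^ 2" by simp
    then have "4 * (real b ^ 2 - real b) \<le> real b ^ 3"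
      by (simp add: algebra_simps power2_eq_square power3_eq_cube)
    ultimately have u54: "u \<le> real b ^ m * (5 / 4)" using od[OF False] by simp
    have u0: "0 < u" using od[OF False] bm \<open>real b < real b ^ 2\<close> by linarith
    \<comment> \<open>(5/4)^3 = 125/64 < 2 \<le> b; this is the source of the margin 1/3.\<close>
    have "real 3 * log (real b) (5 / 4) = log (real b) ((5 / 4) ^ 3)" by (subst log_nat_power) auto
    also have "\<dots> \<le> log (real b) (real b)" using b by (subst log_le_cancel_iff) (auto simp: power3_eq_cube)
    finally have l54: "log (real b) (5 / 4) \<le> 1 / 3" using b by simp
    have "log (real b) u \<le> log (real b) (real b ^ m * (5 / 4))"
      using b u54 u0 bm by (subst log_le_cancel_iff) auto
    also have "\<dots> = real m + log (real b) (5 / 4)" using b bm lm by (subst log_mult) auto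
    finally show ?thesis using l54 by (simp add: beta_log_def u_def)
  qed
qed

text \<open>At t = m the bounding function is the knot formula with each sqrt 5 * F_n replaced by
  golden^n + golden^(-n). By Binet this is an equality for odd n and a strict increase for even
  n.\<close>

lemma knot_value_le_gbound:
  assumes "m \<le> k"
  shows "sqrt 5 * knot_value k m \<le> gbound (real k) (real m)"
    and "even m \<Longrightarrow> sqrt 5 * knot_value k m < gbound (real k) (real m)"
proof -
  define A where "A n = golden powr real n + golden powr (- real n)" for n
  have q: "0 < golden powr (- real n)" for n using golden_gt_1 by simp
  have le: "sqrt 5 * real (fib n) \<le> A n" for n
    using fib_golden[of n] q[of n] by (cases "even n") (simp_all add: A_def)
  have g: "gbound (real k) (real m) = (real k - real m) * A m + A (m + 2)"
    by (simp add: gbound_def A_def algebra_simps)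
  have kv: "sqrt 5 * knot_value k m
      = (real k - real m) * (sqrt 5 * real (fib m)) + sqrt 5 * real (fib (m + 2))"
    by (simp add: knot_value_def algebra_simps)
  have 1: "(real k - real m) * (sqrt 5 * real (fib m)) \<le> (real k - real m) * A m"
    using assms le by (intro mult_left_mono) auto
  then show "sqrt 5 * knot_value k m \<le> gbound (real k) (real m)"
    unfolding g kv using le by (rule add_mono)
  assume "even m"
  then have "sqrt 5 * real (fib (m + 2)) < A (m + 2)"
    using fib_golden[of "m + 2"] q[of "m + 2"] by (simp add: A_def)
  with 1 show "sqrt 5 * knot_value k m < gbound (real k) (real m)"
    unfolding g kv by (rule add_le_less_mono)
qed

text \<open>For odd m strictness comes from beta(h_m) > m and the monotonicity of
  \<open>gbound\<close>, for even m from Binet's formula.\<close>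

lemma knot_value_less_gbound:
  assumes b: "2 \<le> b" and m: "2 \<le> m" "m \<le> k" and k: "3 \<le> k"
  shows "sqrt 5 * knot_value k m < gbound (real k) (beta_log b (real (h_num b m)))"
proof (cases "even m")
  case True
  then show ?thesis using beta_log_h_num(1)[OF b m(1)] knot_value_le_gbound[OF m(2)] by simp
next
  case False
  have "gbound (real k) (real m) < gbound (real k) (beta_log b (real (h_num b m)))"
    using beta_log_h_num(2,3)[OF b m(1)] False m k by (intro gbound_strict_mono) auto
  then show ?thesis using knot_value_le_gbound(1)[OF m(2)] by simp
qed

lemma f_bound_eq_gbound: "f_bound b k x = gbound (real k) (beta_log b x) / sqrt 5"
  by (simp add: f_bound_def gbound_def)

lemma chord_less_gbound:
  assumes b: "2 \<le> b" and m: "2 \<le> m" "m < k" and k: "3 \<le> k"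
    and t: "0 \<le> t" "t \<le> 1" and x: "x = (1 - t) * real (h_num b m) + t * real (h_num b (Suc m))"
  shows "sqrt 5 * ((1 - t) * knot_value k m + t * knot_value k (Suc m)) < gbound (real k) (beta_log b x)"
proof -
  define u where "u y = (real b ^ 2 - 1) * y + 1" for y
  have ulog: "log (real b) (u y) = beta_log b y" for y by (simp add: u_def beta_log_def)
  have b1: "0 \<le> real b ^ 2 - 1" using b by simp
  have mem: "u (real (h_num b i)) \<in> {real b ^ 2..real b powr (real k + 1 / 3)}" if i: "2 \<le> i" "i \<le> k" for i
  proof -
    have "(real b ^ 2 - 1) * 1 \<le> (real b ^ 2 - 1) * real (h_num b i)"
      using b1 h_num_pos[of b i] by (intro mult_left_mono) auto
    then have lo: "real b ^ 2 \<le> u (real (h_num b i))" by (simp add: u_def)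
    moreover have "0 < real b ^ 2" using b by simp
    ultimately have u0: "0 < u (real (h_num b i))" by linarith
    have "u (real (h_num b i)) = real b powr beta_log b (real (h_num b i))"
      unfolding ulog[symmetric] using b u0 by simp
    also have "\<dots> \<le> real b powr (real k + 1 / 3)"
      using beta_log_h_num(3)[OF b i(1)] i b by (intro powr_mono) auto
    finally show ?thesis using lo by simp
  qed
  have "u x = (1 - t) *\<^sub>R u (real (h_num b m)) + t *\<^sub>R u (real (h_num b (Suc m)))"
    unfolding x u_def by (simp add: algebra_simps)
  then have "(1 - t) * gbound (real k) (beta_log b (real (h_num b m)))
      + t * gbound (real k) (beta_log b (real (h_num b (Suc m)))) \<le> gbound (real k) (beta_log b x)"
    using concave_onD[OF gbound_log_concave[OF b, of "real k"] t mem[of m] mem[of "Suc m"]] m k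
    by (simp add: ulog[symmetric])
  moreover have "(1 - t) * (sqrt 5 * knot_value k m) + t * (sqrt 5 * knot_value k (Suc m))
      < (1 - t) * gbound (real k) (beta_log b (real (h_num b m)))
      + t * gbound (real k) (beta_log b (real (h_num b (Suc m))))"
  \<comment> \<open>Strictness must come from an endpoint of positive weight: the left one for t =
    0, otherwise the right one.\<close>
  proof (cases "t = 0")
    case True
    then show ?thesis using knot_value_less_gbound[OF b _ _ k, of m] m by simp
  next
    case False
    have "(1 - t) * (sqrt 5 * knot_value k m) \<le> (1 - t) * gbound (real k) (beta_log b (real (h_num b m)))"
      using knot_value_less_gbound[OF b _ _ k, of m] m t by (intro mult_left_mono) auto
    moreover have "t * (sqrt 5 * knot_value k (Suc m)) < t * gbound (real k) (beta_log b (real (h_num b (Suc m))))"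
      using knot_value_less_gbound[OF b _ _ k, of "Suc m"] m t False by (intro mult_strict_left_mono) auto
    ultimately show ?thesis by (rule add_le_less_mono)
  qed
  ultimately show ?thesis by (simp add: algebra_simps)
qed

theorem theorem36:
  fixes b k n :: nat
  assumes "b \<ge> 2"
    and "k \<ge> 3"
    and "b ^ k < n"
    and "n \<le> b ^ k + h_num b k"
  shows "real (over_count b n) < f_bound b k (real n - real b ^ k)"
proof -
  define x where "x = n - b ^ k"
  have n: "n = b ^ k + x" and x: "1 \<le> x" "x \<le> h_num b k" using assms by (auto simp: x_def)
  obtain m where m: "2 \<le> m" "m \<le> k" "m < k \<or> x = h_num b k \<and> m = k"
    and hm: "h_num b m \<le> x" "x \<le> h_num b (Suc m)"
  proof (cases "x = h_num b k")
    case True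
    then show ?thesis using h_num_strict[of b k] assms by (intro that[of k]) auto
  next
    case False
    with x have "x < h_num b k" by simp
    then show ?thesis using h_num_interval[OF x(1)] that by (metis less_imp_le)
  qed
  define t where "t = knot_param b m x"
  have t: "0 \<le> t" "t \<le> 1" using knot_param_bounds[OF assms(1) m(1) hm] by (auto simp: t_def)
  have "real (over_count b n) \<le> (1 - t) * knot_value k m + t * knot_value k (Suc m)"
    unfolding n t_def
    by (rule over_count_power_add_le_chord[OF assms(1) m(1,2) hm over_count_le_chord[OF assms(1) m(1) hm]])
  then have "sqrt 5 * real (over_count b n) \<le> sqrt 5 * ((1 - t) * knot_value k m + t * knot_value k (Suc m))"
    by (intro mult_left_mono) auto
  also have "\<dots> < gbound (real k) (beta_log b (real x))"
    using m(3)
  proof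
    assume "m < k"
    then show ?thesis
      using knot_param_combination[OF assms(1) m(1), of x, folded t_def] t
      by (intro chord_less_gbound[OF assms(1) m(1) _ assms(2)])
  next
    assume "x = h_num b k \<and> m = k"
    then show ?thesis using knot_value_less_gbound[OF assms(1), of k k] assms
      by (simp add: t_def knot_param_def)
  qed
  finally have "real (over_count b n) < gbound (real k) (beta_log b (real x)) / sqrt 5"
    by (simp add: field_simps)
  moreover have "real n - real b ^ k = real x" by (simp add: n)
  ultimately show ?thesis by (simp add: f_bound_eq_gbound)
qed

end
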